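(* Let $n\ge 2$ and let $sl_n=sl_n(\mathbf{C})$. The dual space $(sl_n)^*$ with the bracket $-2n\,\delta^*:(sl_n)^*\otimes (sl_n)^*\to (sl_n)^*$ is a Lie algebra isomorphic to $sl_n$, and an isomorphism is given by $$B:\ f_{i,j}\longmapsto E_{j,i},$$ where $\{f_{i,j}\mid 1\le i,j\le n\}$ is the basis of $(gl_n)^*\supset (sl_n)^*$ with $f_{i,j}(E_{k,l})=\delta_{i,k}\delta_{j,l}$ (that is, the isomorphism is the restriction to $(sl_n)^*$ of the linear map $B:(gl_n)^*\to gl_n$ so defined).
   Context: $E_{i,j}$ denotes the matrix units in $gl_n=gl_n(\mathbf{C})$, $\delta_{i,k}$ is the Kronecker delta, and $sl_n$ carries the commutator bracket. The linear map $\delta: sl_n\to sl_n\otimes sl_n$ is the restriction to $sl_n$ of the linear map on $gl_n$ given by $$\delta(E_{i,j})=\frac{1}{2n}\sum_{k=1}^{n}\left(E_{i,k}\otimes E_{k,j}-E_{k,j}\otimes E_{i,k}\right);$$ this restriction takes values in $sl_n\otimes sl_n$. The map $\delta^*:(sl_n)^*\otimes(sl_n)^*\to(sl_n)^*$ is defined by $\delta^*(f\otimes g)(x)=(f\otimes g)(\delta(x))$ for $x\in sl_n$. The space $(sl_n)^*$ is regarded as a subspace of $(gl_n)^*$ by extending each functional on $sl_n$ to $gl_n=sl_n\oplus \mathbf{C}I$ by zero on the identity matrix $I$; thus $(sl_n)^*=\{\sum c_{i,j}f_{i,j}: \sum_i c_{i,i}=0\}$. *)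

theory Defs
  imports "HOL-Analysis.Analysis" "HOL-Library.Function_Algebras"
begin

text \<open>
  The index set \<open>{1, \<dots>, n}\<close> is a finite type \<open>'n\<close> with \<open>CARD('n) = n\<close>.  Complex scalar
  multiplication is explicit, since the library's \<open>scaleR\<close> on matrices is only the real one.
\<close>

type_synonym 'n gl = "complex^'n^'n"

definition mscale :: "complex \<Rightarrow> complex^'a^'b \<Rightarrow> complex^'a^'b" where
  "mscale c A = (\<chi> i j. c * A $ i $ j)"

definition fscale :: "complex \<Rightarrow> ('a \<Rightarrow> complex) \<Rightarrow> 'a \<Rightarrow> complex" where
  "fscale c f = (\<lambda>x. c * f x)"

lemma mscale_nth [simp]: "mscale c A $ i $ j = c * A $ i $ j"
  by (simp add: mscale_def)

lemma fscale_apply [simp]: "fscale c f x = c * f x"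
  by (simp add: fscale_def)

lemma vector_space_mscale: "vector_space mscale"
  by unfold_locales (simp_all add: vec_eq_iff algebra_simps)

lemma vector_space_fscale: "vector_space fscale"
  by unfold_locales (simp_all add: fun_eq_iff algebra_simps)

lemma vector_space_complex: "vector_space ((*) :: complex \<Rightarrow> complex \<Rightarrow> complex)"
  by unfold_locales (simp_all add: algebra_simps)


subsection \<open>Lie algebras on a carrier subspace\<close>

locale lie_algebra = vector_space scale
  for scale :: "'k::field \<Rightarrow> 'v::ab_group_add \<Rightarrow> 'v"
    and L :: "'v set"
    and br :: "'v \<Rightarrow> 'v \<Rightarrow> 'v" +
  assumes carrier_subspace: "subspace L"
    and br_closed: "x \<in> L \<Longrightarrow> y \<in> L \<Longrightarrow> br x y \<in> L"
    and br_add_left: "x \<in> L \<Longrightarrow> y \<in> L \<Longrightarrow> z \<in> L \<Longrightarrow> br (x + y) z = br x z + br y z"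
    and br_add_right: "x \<in> L \<Longrightarrow> y \<in> L \<Longrightarrow> z \<in> L \<Longrightarrow> br x (y + z) = br x y + br x z"
    and br_scale_left: "x \<in> L \<Longrightarrow> y \<in> L \<Longrightarrow> br (scale c x) y = scale c (br x y)"
    and br_scale_right: "x \<in> L \<Longrightarrow> y \<in> L \<Longrightarrow> br x (scale c y) = scale c (br x y)"
    and br_alternating: "x \<in> L \<Longrightarrow> br x x = 0"
    and br_jacobi: "x \<in> L \<Longrightarrow> y \<in> L \<Longrightarrow> z \<in> L \<Longrightarrow>
      br x (br y z) + br y (br z x) + br z (br x y) = 0"

locale lie_algebra_iso =
  L1: lie_algebra s1 L1 br1 + L2: lie_algebra s2 L2 br2
  for s1 :: "'k::field \<Rightarrow> 'v::ab_group_add \<Rightarrow> 'v"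
    and L1 :: "'v set" and br1 :: "'v \<Rightarrow> 'v \<Rightarrow> 'v"
    and s2 :: "'k::field \<Rightarrow> 'w::ab_group_add \<Rightarrow> 'w"
    and L2 :: "'w set" and br2 :: "'w \<Rightarrow> 'w \<Rightarrow> 'w"
    and \<phi> :: "'v \<Rightarrow> 'w" +
  assumes iso_bij: "bij_betw \<phi> L1 L2"
    and iso_add: "x \<in> L1 \<Longrightarrow> y \<in> L1 \<Longrightarrow> \<phi> (x + y) = \<phi> x + \<phi> y"
    and iso_scale: "x \<in> L1 \<Longrightarrow> \<phi> (s1 c x) = s2 c (\<phi> x)"
    and iso_br: "x \<in> L1 \<Longrightarrow> y \<in> L1 \<Longrightarrow> \<phi> (br1 x y) = br2 (\<phi> x) (\<phi> y)"


subsection \<open>Matrices and their dual\<close>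

definition E :: "'n::finite \<Rightarrow> 'n \<Rightarrow> 'n gl" where
  "E i j = axis i (axis j 1)"

definition sl :: "'n::finite gl set" where
  "sl = {A. trace A = 0}"

definition commutator :: "'n::finite gl \<Rightarrow> 'n gl \<Rightarrow> 'n gl" where
  "commutator A B = A ** B - B ** A"

definition gl_dual :: "('n::finite gl \<Rightarrow> complex) set" where
  "gl_dual = {f. Vector_Spaces.linear mscale (*) f}"

text \<open>The dual of \<open>sl\<close>, as functionals on \<open>gl = sl \<oplus> \<complex>I\<close> vanishing at the identity matrix.\<close>

definition sl_dual :: "('n::finite gl \<Rightarrow> complex) set" where
  "sl_dual = {f \<in> gl_dual. f (mat 1) = 0}"

definition F :: "'n::finite \<Rightarrow> 'n \<Rightarrow> 'n gl \<Rightarrow> complex" where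
  "F i j = (\<lambda>A. A $ i $ j)"

text \<open>The projection of \<open>gl = sl \<oplus> \<complex>I\<close> onto \<open>sl\<close>.\<close>

definition sl_proj :: "'n::finite gl \<Rightarrow> 'n gl" where
  "sl_proj A = A - mscale (trace A / of_nat CARD('n)) (mat 1)"

text \<open>
  The linear map \<open>gl_dual \<rightarrow> gl\<close> sending \<open>F i j\<close> to \<open>E j i\<close>: the coordinate of \<open>f\<close> at \<open>F i j\<close>
  is \<open>f (E i j)\<close>; see \<open>B_F\<close> and \<open>gl_dual_expand\<close> below.
\<close>

definition B :: "('n::finite gl \<Rightarrow> complex) \<Rightarrow> 'n gl" where
  "B f = (\<Sum>i\<in>UNIV. \<Sum>j\<in>UNIV. mscale (f (E i j)) (E j i))"


subsection \<open>Tensor product, cobracket and its dual\<close>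

text \<open>
  \<open>gl \<otimes> gl\<close> is realised by the Kronecker product as the matrices indexed by pairs; the entry at
  \<open>(i, k), (j, l)\<close> is the coefficient of \<open>E i j \<otimes> E k l\<close>.  The lemmas \<open>span_tensor_gl\<close>,
  \<open>tensor_fun_tensor\<close> and \<open>linear_tensor_fun\<close> below determine \<open>f \<otimes> g\<close> as the unique linear
  functional with \<open>(f \<otimes> g) (X \<otimes> Y) = f X * g Y\<close>.
\<close>

type_synonym 'n gl_gl = "complex^('n \<times> 'n)^('n \<times> 'n)"

definition tensor :: "'n::finite gl \<Rightarrow> 'n gl \<Rightarrow> 'n gl_gl" where
  "tensor X Y = (\<chi> p q. X $ fst p $ fst q * Y $ snd p $ snd q)"

definition tensor_fun ::
  "('n::finite gl \<Rightarrow> complex) \<Rightarrow> ('n gl \<Rightarrow> complex) \<Rightarrow> 'n gl_gl \<Rightarrow> complex" where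
  "tensor_fun f g T = (\<Sum>i\<in>UNIV. \<Sum>j\<in>UNIV. \<Sum>k\<in>UNIV. \<Sum>l\<in>UNIV.
     T $ (i, k) $ (j, l) * (f (E i j) * g (E k l)))"

definition delta :: "'n::finite gl \<Rightarrow> 'n gl_gl" where
  "delta A = (\<Sum>i\<in>UNIV. \<Sum>j\<in>UNIV. mscale (A $ i $ j)
     (mscale (1 / (2 * of_nat CARD('n)))
       (\<Sum>k\<in>UNIV. tensor (E i k) (E k j) - tensor (E k j) (E i k))))"

text \<open>
  \<open>(gl \<otimes> gl)\<^sup>*\<close> is identified with \<open>gl\<^sup>* \<otimes> gl\<^sup>*\<close>.  The functional \<open>x \<mapsto> \<phi> (delta x)\<close> on \<open>sl\<close> is
  extended by zero on the identity matrix.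
\<close>

definition delta_star :: "('n::finite gl_gl \<Rightarrow> complex) \<Rightarrow> 'n gl \<Rightarrow> complex" where
  "delta_star \<phi> = (\<lambda>A. \<phi> (delta (sl_proj A)))"

definition dual_bracket ::
  "('n::finite gl \<Rightarrow> complex) \<Rightarrow> ('n gl \<Rightarrow> complex) \<Rightarrow> 'n gl \<Rightarrow> complex" where
  "dual_bracket f g = fscale (- 2 * of_nat CARD('n)) (delta_star (tensor_fun f g))"


subsection \<open>The definitions agree with their descriptions\<close>

lemma E_nth: "E i j $ a $ b = (if a = i \<and> b = j then 1 else 0)"
  by (simp add: E_def axis_def)

lemma sum_E_nth:
  "(\<Sum>i\<in>UNIV. \<Sum>j\<in>UNIV. h i j * E i j $ a $ b) = h a b"
proof -
  have "h i j * E i j $ a $ b = (if i = a then if j = b then h i j else 0 else 0)" for i j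
    by (simp add: E_nth)
  moreover have "(\<Sum>j\<in>UNIV. if i = a then if j = b then h i j else 0 else 0)
      = (if i = a then h i b else 0)" for i
    by simp
  ultimately show ?thesis by simp
qed

lemma gl_expand: "A = (\<Sum>i\<in>UNIV. \<Sum>j\<in>UNIV. mscale (A $ i $ j) (E i j))"
  by (simp add: vec_eq_iff sum_E_nth)

lemma gl_dual_eval:
  assumes "f \<in> gl_dual"
  shows "f A = (\<Sum>i\<in>UNIV. \<Sum>j\<in>UNIV. A $ i $ j * f (E i j))"
proof -
  interpret Vector_Spaces.linear mscale "(*)" f using assms by (simp add: gl_dual_def)
  have "f A = f (\<Sum>i\<in>UNIV. \<Sum>j\<in>UNIV. mscale (A $ i $ j) (E i j))"
    using gl_expand[of A] by simp
  then show ?thesis by (simp add: sum scale)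
qed

lemma gl_dualI:
  assumes "\<And>X Y. f (X + Y) = f X + f Y" "\<And>c X. f (mscale c X) = c * f X"
  shows "f \<in> gl_dual"
  unfolding gl_dual_def mem_Collect_eq Vector_Spaces.linear_def module_hom_def module_hom_axioms_def
  using vector_space_mscale vector_space_complex assms
  by (simp add: module_iff_vector_space)

lemma F_E: "F i j (E k l) = (if i = k \<and> j = l then 1 else 0)"
  by (auto simp: F_def E_nth)

lemma F_gl_dual: "F i j \<in> gl_dual"
  by (rule gl_dualI) (simp_all add: F_def)

lemma gl_dual_expand:
  assumes "f \<in> gl_dual"
  shows "f = (\<Sum>i\<in>UNIV. \<Sum>j\<in>UNIV. fscale (f (E i j)) (F i j))"
proof
  fix A
  have app: "(\<Sum>i\<in>S. h i) x = (\<Sum>i\<in>S. h i x)" for S :: "'n set" and h :: "'n \<Rightarrow> 'n gl \<Rightarrow> complex" and x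
    by (induction S rule: infinite_finite_induct) auto
  show "f A = (\<Sum>i\<in>UNIV. \<Sum>j\<in>UNIV. fscale (f (E i j)) (F i j)) A"
    by (subst gl_dual_eval[OF assms]) (simp add: app F_def mult.commute)
qed

lemma sl_dual_iff:
  "f \<in> sl_dual \<longleftrightarrow> f \<in> gl_dual \<and> (\<Sum>i\<in>UNIV. f (E i i)) = 0"
proof -
  have "f (mat 1) = (\<Sum>i\<in>UNIV. f (E i i))" if "f \<in> gl_dual"
    by (subst gl_dual_eval[OF that]) (simp add: mat_def if_distrib[of "\<lambda>x. x * _"] cong: if_cong)
  then show ?thesis by (auto simp: sl_dual_def)
qed

lemma B_F: "B (F i j) = E j i"
proof -
  have "(\<Sum>k\<in>UNIV. \<Sum>l\<in>UNIV. F i j (E k l) * E l k $ a $ b) = E j i $ a $ b" for a b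
    by (subst sum.swap, subst sum_E_nth) (auto simp: F_E E_nth)
  then show ?thesis by (simp add: B_def vec_eq_iff)
qed

lemma B_add: "B (f + g) = B f + B g"
  by (simp add: B_def vec_eq_iff sum.distrib algebra_simps)

lemma B_scale: "B (fscale c f) = mscale c (B f)"
  by (simp add: B_def vec_eq_iff sum_distrib_left algebra_simps)

lemma sl_proj_sl: "sl_proj (A :: 'n::finite gl) \<in> sl"
proof -
  have "trace (mscale c (mat 1) :: 'n gl) = c * of_nat CARD('n)" for c
    by (simp add: trace_def mat_def)
  then show ?thesis by (simp add: sl_def sl_proj_def trace_sub)
qed

lemma sl_proj_id: "A \<in> sl \<Longrightarrow> sl_proj A = A"
  by (simp add: sl_def sl_proj_def vec_eq_iff)

lemma sl_proj_mat_1: "sl_proj (mat 1) = 0"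
  by (simp add: sl_proj_def trace_I vec_eq_iff)

lemma delta_E:
  "delta (E i j :: 'n::finite gl) = mscale (1 / (2 * of_nat CARD('n)))
     (\<Sum>k\<in>UNIV. tensor (E i k) (E k j) - tensor (E k j) (E i k))"
proof -
  have *: "(\<Sum>a\<in>UNIV. \<Sum>b\<in>UNIV. E i j $ a $ b * h a b) = h i j"
    for h :: "'n \<Rightarrow> 'n \<Rightarrow> complex"
  proof -
    have "E i j $ a $ b * h a b = (if a = i then if b = j then h a b else 0 else 0)" for a b
      by (simp add: E_nth)
    moreover have "(\<Sum>b\<in>UNIV. if a = i then if b = j then h a b else 0 else 0)
        = (if a = i then h a j else 0)" for a
      by simp
    ultimately show ?thesis by simp
  qed
  show ?thesis unfolding delta_def vec_eq_iff sum_component mscale_nth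
    by (intro allI) (rule *)
qed

lemma delta_add: "delta (X + Y) = delta X + delta Y"
  by (simp add: delta_def vec_eq_iff sum.distrib distrib_right add_divide_distrib)

lemma delta_scale: "delta (mscale c X) = mscale c (delta X)"
  by (simp add: delta_def vec_eq_iff sum_distrib_left mult.assoc)

lemma delta_star_sl: "A \<in> sl \<Longrightarrow> delta_star \<phi> A = \<phi> (delta A)"
  by (simp add: delta_star_def sl_proj_id)

lemma linear_tensor_fun: "Vector_Spaces.linear mscale (*) (tensor_fun f g)"
  unfolding Vector_Spaces.linear_def module_hom_def module_hom_axioms_def
  using vector_space_mscale vector_space_complex
  by (simp add: module_iff_vector_space tensor_fun_def sum.distrib sum_distrib_left algebra_simps)

lemma tensor_fun_tensor:
  assumes "f \<in> gl_dual" "g \<in> gl_dual"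
  shows "tensor_fun f g (tensor X Y) = f X * g Y"
  unfolding gl_dual_eval[OF assms(1), of X] gl_dual_eval[OF assms(2), of Y]
    tensor_fun_def
  unfolding sum_distrib_right
  unfolding sum_distrib_left
  by (simp add: tensor_def mult_ac)

lemma span_tensor_gl: "module.span mscale {tensor X Y |X Y. True} = (UNIV :: 'n::finite gl_gl set)"
proof -
  interpret vector_space "mscale :: complex \<Rightarrow> 'n gl_gl \<Rightarrow> 'n gl_gl" by (rule vector_space_mscale)
  have "T \<in> span {tensor X Y |X Y. True}" for T :: "'n gl_gl"
  proof -
    have "(\<Sum>p\<in>UNIV. \<Sum>q\<in>UNIV. mscale (T $ p $ q) (tensor (E (fst p) (fst q)) (E (snd p) (snd q))))
        \<in> span {tensor X Y |X Y. True}" (is "?S \<in> _")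
      by (intro span_sum span_scale span_base) blast
    moreover have "tensor (E (fst p) (fst q)) (E (snd p) (snd q)) = E p q" for p q :: "'n \<times> 'n"
      by (auto simp: vec_eq_iff tensor_def E_nth prod_eq_iff)
    ultimately show ?thesis using gl_expand[of T] by simp
  qed
  then show ?thesis by blast
qed

text \<open>\<open>delta\<close> takes values in \<open>sl \<otimes> sl\<close>.\<close>

lemma delta_sl_sl:
  "delta (A :: 'n::finite gl) \<in> module.span mscale {tensor X Y |X Y. X \<in> sl \<and> Y \<in> sl}"
proof -
  interpret vector_space "mscale :: complex \<Rightarrow> 'n gl_gl \<Rightarrow> 'n gl_gl" by (rule vector_space_mscale)
  let ?S = "span {tensor X Y |X Y :: 'n gl. X \<in> sl \<and> Y \<in> sl}"
  have tS: "tensor X Y \<in> ?S" if "X \<in> sl" "Y \<in> sl" for X Y :: "'n gl"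
    using that by (intro span_base) blast
  have Esl: "E i j \<in> sl" if "i \<noteq> j" for i j :: 'n
    using that by (auto simp: sl_def trace_def E_nth intro!: sum.neutral)
  have Hsl: "E j j - E i i \<in> sl" for i j :: 'n
    by (simp add: sl_def trace_sub) (simp add: trace_def E_nth)
  let ?t = "\<lambda>i j k :: 'n. tensor (E i k) (E k j) - tensor (E k j) (E i k)"
  have *: "(\<Sum>k\<in>UNIV. ?t i j k) \<in> ?S" for i j
  proof (cases "i = j")
    case True
    have "?t i i k \<in> ?S" for k
      by (cases "k = i") (auto intro!: span_diff tS Esl span_zero)
    then show ?thesis unfolding True by (intro span_sum) simp
  next
    case False
    have "(\<Sum>k\<in>UNIV. ?t i j k) = (\<Sum>k\<in>UNIV - {i, j}. ?t i j k) + (\<Sum>k\<in>{i, j}. ?t i j k)"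
      by (rule sum.subset_diff) auto
    also have "(\<Sum>k\<in>{i, j}. ?t i j k) =
        tensor (E i j) (E j j - E i i) - tensor (E j j - E i i) (E i j)"
      using False by (simp add: vec_eq_iff tensor_def algebra_simps)
    finally show ?thesis
      using False by (simp only:) (intro span_add span_sum span_diff tS Esl Hsl; blast)
  qed
  show ?thesis unfolding delta_def by (intro span_sum span_scale *)
qed

end

theory Submission
  imports Defs
begin

text \<open>
  Every functional on \<open>gl\<close> is represented by a unique matrix through the trace form, and \<open>B f\<close> is
  that matrix: \<open>f A = trace (A ** B f)\<close> (\<open>gl_dual_trace_form\<close>).  Hence \<open>B\<close> is a linear bijection
  from \<open>gl_dual\<close> onto \<open>gl\<close>; since \<open>f (mat 1) = trace (B f)\<close>, it matches the functionals vanishing at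
  the identity with the traceless matrices (\<open>bij_betw_B_sl\<close>).

  The cobracket is dual to the commutator for this form.  Evaluating \<open>f \<otimes> g\<close> on the defining sum of
  \<open>delta (E i j)\<close> gives a multiple of
  \<open>(\<Sum>k. f (E i k) * g (E k j) - f (E k j) * g (E i k))\<close>, which is the \<open>(j, i)\<close> entry of
  \<open>B g ** B f - B f ** B g\<close>; the factor \<open>-2n\<close> removes both the normalisation and the sign.  So the
  bracket of \<open>f\<close> and \<open>g\<close> is the functional represented by the commutator of \<open>B f\<close> and \<open>B g\<close>
  (\<open>dual_bracket_trace_form\<close>).  The functional \<open>A \<mapsto> trace (A ** [B f, B g])\<close> already
  vanishes at the identity, a commutator being traceless, so it is the extension by zero of its
  restriction to \<open>sl\<close>.

  Thus \<open>B\<close> carries the dual bracket to the commutator, and the Lie algebra axioms on the dual are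
  pulled back from \<open>sl\<close> along it (\<open>lie_algebra_iso_pullback\<close>).
\<close>

text \<open>
  Every axiom but closure is an identity between elements of \<open>L1\<close>, so by injectivity of \<open>\<phi>\<close> it may be checked
  after applying \<open>\<phi>\<close>, where it becomes the same axiom in \<open>L2\<close>.
\<close>

lemma lie_algebra_iso_pullback:
  assumes L2: "lie_algebra s2 L2 br2"
    and vs: "vector_space s1" and sub: "module.subspace s1 L1"
    and closed: "\<And>x y. x \<in> L1 \<Longrightarrow> y \<in> L1 \<Longrightarrow> br1 x y \<in> L1"
    and bij: "bij_betw \<phi> L1 L2"
    and add: "\<And>x y. x \<in> L1 \<Longrightarrow> y \<in> L1 \<Longrightarrow> \<phi> (x + y) = \<phi> x + \<phi> y"
    and scale: "\<And>c x. x \<in> L1 \<Longrightarrow> \<phi> (s1 c x) = s2 c (\<phi> x)"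
    and br: "\<And>x y. x \<in> L1 \<Longrightarrow> y \<in> L1 \<Longrightarrow> \<phi> (br1 x y) = br2 (\<phi> x) (\<phi> y)"
  shows "lie_algebra_iso s1 L1 br1 s2 L2 br2 \<phi>"
proof -
  interpret V1: vector_space s1 by (rule vs)
  interpret L2: lie_algebra s2 L2 br2 by (rule L2)
  note mem [simp] = closed V1.subspace_add[OF sub] V1.subspace_scale[OF sub] V1.subspace_0[OF sub]
  have im [simp]: "\<phi> x \<in> L2" if "x \<in> L1" for x
    using bij that by (auto dest: bij_betwE)
  have inj: "x = y" if "\<phi> x = \<phi> y" "x \<in> L1" "y \<in> L1" for x y
    using bij that by (auto simp: bij_betw_def dest: inj_onD)
  have zero: "\<phi> 0 = 0"
    using add[of 0 0] by simp
  note hom = add scale br zero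
  have "lie_algebra s1 L1 br1"
  proof unfold_locales
    show "V1.subspace L1" by (rule sub)
  qed (rule inj closed;
      simp add: hom L2.br_add_left L2.br_add_right L2.br_scale_left L2.br_scale_right
        L2.br_alternating L2.br_jacobi)+
  then show ?thesis
    by (intro lie_algebra_iso.intro lie_algebra_iso_axioms.intro L2 bij hom)
qed

lemma trace_mscale: "trace (mscale c A) = c * trace A"
  by (simp add: trace_def sum_distrib_left)

lemma trace_commutator: "trace (commutator X Y) = 0"
  by (simp add: commutator_def trace_sub trace_mul_sym[of X Y])

lemma mscale_matrix_mult: "mscale c X ** Y = mscale c (X ** Y)" "X ** mscale c Y = mscale c (X ** Y)"
  by (simp_all add: matrix_matrix_mult_def vec_eq_iff sum_distrib_left mult_ac)

lemma mscale_diff: "mscale c (X - Y) = mscale c X - mscale c Y"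
  by (simp add: vec_eq_iff algebra_simps)

lemma matrix_mult_distrib:
  fixes X Y Z :: "'n::finite gl"
  shows "(Y + Z) ** X = Y ** X + Z ** X"
    and "X ** (Y - Z) = X ** Y - X ** Z" and "(Y - Z) ** X = Y ** X - Z ** X"
  by (simp_all add: matrix_matrix_mult_def vec_eq_iff sum.distrib sum_subtractf algebra_simps)

lemma lie_algebra_sl: "lie_algebra mscale (sl :: 'n::finite gl set) commutator"
proof -
  interpret V: vector_space "mscale :: complex \<Rightarrow> 'n gl \<Rightarrow> 'n gl" by (rule vector_space_mscale)
  show ?thesis
  proof unfold_locales
    show "V.subspace (sl :: 'n gl set)"
      by (rule V.subspaceI) (simp_all add: sl_def trace_add trace_mscale, simp add: trace_def)
    fix X Y Z :: "'n gl"
    show "commutator X (commutator Y Z) + commutator Y (commutator Z X)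
        + commutator Z (commutator X Y) = 0"
      by (simp add: commutator_def matrix_mult_distrib matrix_mul_assoc)
  qed (simp_all add: sl_def trace_commutator, simp_all add: commutator_def matrix_add_ldistrib
      matrix_mult_distrib mscale_matrix_mult mscale_diff)
qed

lemma B_nth: "B f $ a $ b = f (E b a)"
  unfolding B_def by (subst sum.swap) (simp add: sum_E_nth)

lemma trace_form_eq: "trace (A ** X) = (\<Sum>i\<in>UNIV. \<Sum>j\<in>UNIV. A $ i $ j * X $ j $ i)"
  by (simp add: trace_def matrix_matrix_mult_def)

lemma gl_dual_linear:
  assumes "f \<in> gl_dual"
  shows "f (X + Y) = f X + f Y" and "f (mscale c X) = c * f X"
proof -
  interpret Vector_Spaces.linear mscale "(*)" f using assms by (simp add: gl_dual_def)
  show "f (X + Y) = f X + f Y" by (rule add)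
  show "f (mscale c X) = c * f X" by (rule scale)
qed

text \<open>
  The matrix of \<open>f\<close> is \<open>B f\<close> with no transpose, because \<open>trace (A ** X)\<close> multiplies \<open>A $ i $ j\<close> with
  \<open>X $ j $ i\<close> and \<open>B\<close> sends \<open>F i j\<close> to \<open>E j i\<close>.
\<close>

lemma gl_dual_trace_form:
  assumes "f \<in> gl_dual"
  shows "f A = trace (A ** B f)"
  unfolding trace_form_eq B_nth by (rule gl_dual_eval[OF assms])

lemma trace_form_gl_dual: "(\<lambda>A. trace (A ** X)) \<in> gl_dual"
  by (rule gl_dualI) (simp_all add: matrix_mult_distrib trace_add mscale_matrix_mult trace_mscale)

text \<open>
  Together with \<open>gl_dual_trace_form\<close>, this makes \<open>X \<mapsto> (\<lambda>A. trace (A ** X))\<close> the two-sided inverse of \<open>B\<close>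
  on \<open>gl_dual\<close>.
\<close>

lemma B_trace_form:
  fixes X :: "'n::finite gl"
  shows "B (\<lambda>A. trace (A ** X)) = X"
proof -
  \<comment> \<open>The conditions are nested so that the double sum collapses one index at a time.\<close>
  have "E b a $ i $ j * x = (if i = b then if j = a then x else 0 else 0)"
    for a b i j :: 'n and x
    by (simp add: E_nth)
  moreover have "(\<Sum>j\<in>UNIV. if i = b then if j = a then X $ j $ i else 0 else 0)
      = (if i = b then X $ a $ i else 0)" for a b i
    by simp
  ultimately have "trace (E b a ** X) = X $ a $ b" for a b
    by (simp add: trace_form_eq)
  then show ?thesis by (simp add: vec_eq_iff B_nth)
qed

text \<open>At the identity the represented functional takes the value \<open>trace X\<close>.\<close>

lemma trace_form_sl_dual_iff: "(\<lambda>A. trace (A ** X)) \<in> sl_dual \<longleftrightarrow> X \<in> sl"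
  by (simp add: sl_dual_def trace_form_gl_dual sl_def)

lemma bij_betw_B_sl: "bij_betw B (sl_dual :: ('n::finite gl \<Rightarrow> complex) set) sl"
proof (rule bij_betw_byWitness[where f' = "\<lambda>X A. trace (A ** X)"])
  have rep: "f = (\<lambda>A. trace (A ** B f))" if "f \<in> sl_dual" for f :: "'n gl \<Rightarrow> complex"
    using that by (intro ext gl_dual_trace_form) (simp add: sl_dual_def)
  show "\<forall>f\<in>sl_dual :: ('n gl \<Rightarrow> complex) set. (\<lambda>A. trace (A ** B f)) = f"
    by (intro ballI rep[symmetric])
  show "B ` (sl_dual :: ('n gl \<Rightarrow> complex) set) \<subseteq> sl"
    using gl_dual_trace_form[of _ "mat 1"] by (fastforce simp: sl_dual_def sl_def)
  show "\<forall>X\<in>sl :: 'n gl set. B (\<lambda>A. trace (A ** X)) = X"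
    by (simp add: B_trace_form)
  show "(\<lambda>X A. trace (A ** X)) ` (sl :: 'n gl set) \<subseteq> sl_dual"
    by (simp add: image_subset_iff trace_form_sl_dual_iff)
qed

lemma subspace_sl_dual: "module.subspace fscale (sl_dual :: ('n::finite gl \<Rightarrow> complex) set)"
proof -
  interpret V: vector_space "fscale :: complex \<Rightarrow> ('n gl \<Rightarrow> complex) \<Rightarrow> _"
    by (rule vector_space_fscale)
  have "f + g \<in> gl_dual" if "f \<in> gl_dual" "g \<in> gl_dual" for f g :: "'n gl \<Rightarrow> complex"
    by (rule gl_dualI) (simp_all add: that[THEN gl_dual_linear(1)] that[THEN gl_dual_linear(2)] algebra_simps)
  moreover have "fscale c f \<in> gl_dual" if "f \<in> gl_dual" for f :: "'n gl \<Rightarrow> complex" and c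
    by (rule gl_dualI) (simp_all add: gl_dual_linear[OF that] algebra_simps)
  moreover have "0 \<in> (gl_dual :: ('n gl \<Rightarrow> complex) set)"
    by (rule gl_dualI) simp_all
  ultimately show ?thesis
    by (intro V.subspaceI) (auto simp: sl_dual_def)
qed

text \<open>
  The minus sign comes from \<open>B\<close> reversing products: the sum of \<open>f (E i k) * g (E k j)\<close> over \<open>k\<close> is an
  entry of \<open>B g ** B f\<close>.
\<close>

lemma tensor_fun_delta:
  fixes f g :: "'n::finite gl \<Rightarrow> complex"
  assumes f: "f \<in> gl_dual" and g: "g \<in> gl_dual"
  shows "tensor_fun f g (delta A) =
    - (1 / (2 * of_nat CARD('n))) * trace (A ** commutator (B f) (B g))"
proof -
  interpret T: Vector_Spaces.linear mscale "(*)" "tensor_fun f g" by (rule linear_tensor_fun)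
  have entry: "(\<Sum>k\<in>UNIV. f (E i k) * g (E k j) - f (E k j) * g (E i k))
      = - commutator (B f) (B g) $ j $ i" for i j
    by (simp add: commutator_def matrix_matrix_mult_def B_nth sum_subtractf mult.commute)
  have "tensor_fun f g (delta A) = (\<Sum>i\<in>UNIV. \<Sum>j\<in>UNIV. A $ i $ j * (1 / (2 * of_nat CARD('n)) *
      (\<Sum>k\<in>UNIV. f (E i k) * g (E k j) - f (E k j) * g (E i k))))"
    unfolding delta_def T.sum T.scale T.diff tensor_fun_tensor[OF f g] ..
  also have "\<dots> = - (1 / (2 * of_nat CARD('n))) * trace (A ** commutator (B f) (B g))"
    unfolding entry trace_form_eq sum_distrib_left by (simp add: mult_ac)
  finally show ?thesis .
qed

text \<open>
  The projection to \<open>sl\<close> inside \<open>delta_star\<close> changes \<open>A\<close> by a multiple of the identity, to which the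
  traceless commutator is orthogonal.
\<close>

lemma dual_bracket_trace_form:
  fixes f g :: "'n::finite gl \<Rightarrow> complex"
  assumes "f \<in> gl_dual" "g \<in> gl_dual"
  shows "dual_bracket f g = (\<lambda>A. trace (A ** commutator (B f) (B g)))"
proof
  fix A :: "'n gl"
  have "trace (sl_proj A ** commutator (B f) (B g)) = trace (A ** commutator (B f) (B g))"
    by (simp add: sl_proj_def matrix_mult_distrib mscale_matrix_mult trace_sub trace_mscale
        trace_commutator)
  then show "dual_bracket f g A = trace (A ** commutator (B f) (B g))"
    by (simp add: dual_bracket_def delta_star_def tensor_fun_delta[OF assms])
qed

theorem theorem5p1:
  assumes "CARD('n::finite) \<ge> 2"
  shows "lie_algebra fscale (sl_dual :: ('n gl \<Rightarrow> complex) set) dual_bracket \<and>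
    lie_algebra_iso fscale (sl_dual :: ('n gl \<Rightarrow> complex) set) dual_bracket
      mscale (sl :: 'n gl set) commutator B \<and>
    (\<forall>i j :: 'n. B (F i j) = E j i)"
proof -
  have gl: "f \<in> gl_dual" if "f \<in> sl_dual" for f :: "'n gl \<Rightarrow> complex"
    using that by (simp add: sl_dual_def)
  have iso: "lie_algebra_iso fscale (sl_dual :: ('n gl \<Rightarrow> complex) set) dual_bracket
      mscale (sl :: 'n gl set) commutator B"
  proof (rule lie_algebra_iso_pullback)
    fix f g :: "'n gl \<Rightarrow> complex"
    assume "f \<in> sl_dual" "g \<in> sl_dual"
    then have br: "dual_bracket f g = (\<lambda>A. trace (A ** commutator (B f) (B g)))"
      by (intro dual_bracket_trace_form gl)
    show "dual_bracket f g \<in> sl_dual"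
      unfolding br trace_form_sl_dual_iff by (simp add: sl_def trace_commutator)
    show "B (dual_bracket f g) = commutator (B f) (B g)"
      unfolding br by (rule B_trace_form)
  qed (rule lie_algebra_sl vector_space_fscale subspace_sl_dual bij_betw_B_sl B_add B_scale)+
  then show ?thesis
    by (auto simp: B_F dest: lie_algebra_iso.axioms(1))
qed

end
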